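(* Assume that (OA0), (OA1) and (OA2) (listed in the context) hold, that $B(\omega)$ is nonsingular for each $\omega\in\Omega$, and that $$\lim_{t\to\infty}\frac{\ln\|U_\omega(t)\|}{t}>-\infty\quad\text{for }\mathbb P\text{-a.e. }\omega\in\Omega.$$ Then for $\mathbb P$-a.e. $\omega\in\Omega$ there exists a nontrivial entire positive solution of the delay system (D)$_\omega$, that is, a mapping $v_\omega\colon\mathbb R\to C([-1,0],\mathbb R^N)^+$, not identically zero, such that $v_\omega(s+t)=U_{\theta_s\omega}(t)v_\omega(s)$ for all $s\in\mathbb R$ and $t\ge0$.
   Context: $(\Omega,\mathfrak F,\mathbb P)$ is a complete probability space and $(\theta_t)_{t\in\mathbb R}$ is an ergodic metric dynamical system on it: a $(\mathfrak B(\mathbb R)\otimes\mathfrak F,\mathfrak F)$-measurable flow preserving $\mathbb P$, such that every $F\in\mathfrak F$ with $\theta_t(F)=F$ for all $t$ has $\mathbb P(F)\in\{0,1\}$. Let $N\ge2$ and $A=(a_{ij}),B=(b_{ij})\colon\Omega\to\mathbb R^{N\times N}$. The delay system (D)$_\omega$ is $$\frac{du}{dt}=A(\theta_t\omega)u(t)+B(\theta_t\omega)u(t-1),\quad u\in\mathbb R^N.$$ (OA0) $A,B$ are $(\mathfrak F,\mathfrak B(\mathbb R^{N\times N}))$-measurable and $t\mapsto A(\theta_t\omega)$, $t\mapsto B(\theta_t\omega)$ are continuous on $\mathbb R$ for all $\omega\in\Omega$. (OA1) $a_{ij}(\omega)\ge0$ for all $i\ne j$ and all $\omega$; $b_{ij}(\omega)\ge0$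 for all $i,j$ and all $\omega$. (OA2) The functions $\omega\mapsto\max_{1\le i,j\le N}a_{ij}(\omega)$ and $\omega\mapsto\max_{1\le i,j\le N}b_{ij}(\omega)$ belong to $L_1((\Omega,\mathfrak F,\mathbb P))$. For $u_0\in C([-1,0],\mathbb R^N)$, $u(\cdot;\omega,u_0)\colon[-1,\infty)\to\mathbb R^N$ is the unique solution of (D)$_\omega$ for $t\ge0$ (right-hand derivative at $0$) with $u(\tau;\omega,u_0)=u_0(\tau)$ for $\tau\in[-1,0]$. Put $(U_\omega(t)u_0)(\tau)=u(t+\tau;\omega,u_0)$, $\tau\in[-1,0]$, $t\ge0$; this is a bounded linear operator on $C([-1,0],\mathbb R^N)$. $\|\cdot\|$ is the maximum norm (based on the Euclidean norm of $\mathbb R^N$) or the operator norm. $C([-1,0],\mathbb R^N)^+$ is the cone of functions with all components nonnegative. *)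

theory Defs
  imports "HOL-Probability.Probability"
begin

locale ergodic_mds = prob_space M + complete_measure M
  for M :: "'w measure" +
  fixes \<theta> :: "real \<Rightarrow> 'w \<Rightarrow> 'w"
  assumes flow_measurable: "(\<lambda>(t, \<omega>). \<theta> t \<omega>) \<in> borel \<Otimes>\<^sub>M M \<rightarrow>\<^sub>M M"
    and flow_0: "\<And>\<omega>. \<omega> \<in> space M \<Longrightarrow> \<theta> 0 \<omega> = \<omega>"
    and flow_add: "\<And>s t \<omega>. \<omega> \<in> space M \<Longrightarrow> \<theta> (s + t) \<omega> = \<theta> s (\<theta> t \<omega>)"
    and flow_preserving: "\<And>t. distr M M (\<theta> t) = M"
    and flow_ergodic: "\<And>F. F \<in> sets M \<Longrightarrow> (\<And>t. \<theta> t ` F = F) \<Longrightarrow> prob F \<in> {0, 1}"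

typedef delay_interval = "{-1..0::real}"
  morphisms delay_val Delay_val
  by (rule exI[of _ 0]) simp

setup_lifting type_definition_delay_interval

instantiation delay_interval :: metric_space
begin

lift_definition dist_delay_interval :: "delay_interval \<Rightarrow> delay_interval \<Rightarrow> real" is dist .

definition uniformity_delay_interval :: "(delay_interval \<times> delay_interval) filter"
  where "uniformity_delay_interval = (INF e\<in>{0 <..}. principal {(x, y). dist x y < e})"

definition open_delay_interval :: "delay_interval set \<Rightarrow> bool"
  where "open_delay_interval S = (\<forall>x\<in>S. \<forall>\<^sub>F (x', y) in uniformity. x' = x \<longrightarrow> y \<in> S)"

instance
proof
  fix x y z :: delay_interval
  show "(dist x y = 0) = (x = y)"
    by transfer simp
  show "dist x y \<le> dist x z + dist y z"
    by transfer (rule dist_triangle2)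
qed (rule uniformity_delay_interval_def open_delay_interval_def)+

end

text \<open>
  The type \<open>delay_interval \<Rightarrow>\<^sub>C (real^'n)\<close> is the space of continuous functions from
  \<open>[-1,0]\<close> to \<open>\<real>\<^sup>N\<close>, because \<open>[-1,0]\<close> is compact: bounded continuity is just
  continuity, as the following lemmas show. Its library norm is the maximum norm based on the
  Euclidean norm of \<open>real^'n\<close>, and \<^const>\<open>onorm\<close> is the corresponding operator norm.
\<close>

lemma continuous_on_delay_val: "continuous_on S delay_val"
  unfolding continuous_on_iff by (metis dist_delay_interval.rep_eq)

lemma compact_delay_interval: "compact (UNIV :: delay_interval set)"
proof -
  have "continuous_on {-1..0} Delay_val"
    unfolding continuous_on_iff
    by (metis Delay_val_inverse dist_delay_interval.rep_eq)
  moreover have "Delay_val ` {-1..0} = UNIV"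
    by (metis type_definition.Abs_image type_definition_delay_interval)
  ultimately show ?thesis
    by (metis compact_Icc compact_continuous_image)
qed

lemma segment_in_bcontfun:
  fixes f :: "real \<Rightarrow> 'a::metric_space"
  assumes "continuous_on {t - 1..t} f"
  shows "(\<lambda>\<tau>. f (t + delay_val \<tau>)) \<in> bcontfun"
proof -
  have r: "-1 \<le> delay_val \<tau> \<and> delay_val \<tau> \<le> 0" for \<tau>
    using delay_val[of \<tau>] by simp
  have "continuous_on UNIV (\<lambda>\<tau>. t + delay_val \<tau>)"
    by (intro continuous_intros continuous_on_delay_val)
  then have "continuous_on UNIV (\<lambda>\<tau>. f (t + delay_val \<tau>))"
    by (rule continuous_on_compose2[OF assms]) (use r in auto)
  then show ?thesis
    unfolding bcontfun_def
    using compact_delay_interval compact_continuous_image compact_imp_bounded by blast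
qed

definition nonneg_cone :: "(delay_interval \<Rightarrow>\<^sub>C (real^'n)) set" where
  "nonneg_cone = {v. \<forall>\<tau> i. 0 \<le> apply_bcontfun v \<tau> $ i}"

text \<open>
  A function on \<open>[-1,\<infinity>)\<close> is represented by an extensional function on \<open>{-1..}\<close>, so that the
  solution of an initial value problem is unique as a HOL function. The derivative at \<open>0\<close> within
  \<open>{0..}\<close> is the right-hand one; at \<open>t > 0\<close> it is the two-sided one.
\<close>

definition is_delay_solution ::
    "(real \<Rightarrow> 'w \<Rightarrow> 'w) \<Rightarrow> ('w \<Rightarrow> real^'n^'n) \<Rightarrow> ('w \<Rightarrow> real^'n^'n) \<Rightarrow> 'w \<Rightarrow>
      (delay_interval \<Rightarrow>\<^sub>C (real^'n)) \<Rightarrow> (real \<Rightarrow> real^'n) \<Rightarrow> bool" where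
  "is_delay_solution \<theta> A B \<omega> u0 u \<longleftrightarrow>
     u \<in> extensional {-1..} \<and>
     (\<forall>\<tau>. u (delay_val \<tau>) = apply_bcontfun u0 \<tau>) \<and>
     (\<forall>t\<ge>0. (u has_vector_derivative
               A (\<theta> t \<omega>) *v u t + B (\<theta> t \<omega>) *v u (t - 1)) (at t within {0..}))"

definition delay_solution ::
    "(real \<Rightarrow> 'w \<Rightarrow> 'w) \<Rightarrow> ('w \<Rightarrow> real^'n^'n) \<Rightarrow> ('w \<Rightarrow> real^'n^'n) \<Rightarrow> 'w \<Rightarrow>
      (delay_interval \<Rightarrow>\<^sub>C (real^'n)) \<Rightarrow> real \<Rightarrow> real^'n" where
  "delay_solution \<theta> A B \<omega> u0 = (THE u. is_delay_solution \<theta> A B \<omega> u0 u)"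

definition delay_semiflow ::
    "(real \<Rightarrow> 'w \<Rightarrow> 'w) \<Rightarrow> ('w \<Rightarrow> real^'n^'n) \<Rightarrow> ('w \<Rightarrow> real^'n^'n) \<Rightarrow> 'w \<Rightarrow> real \<Rightarrow>
      (delay_interval \<Rightarrow>\<^sub>C (real^'n)) \<Rightarrow> (delay_interval \<Rightarrow>\<^sub>C (real^'n))" where
  "delay_semiflow \<theta> A B \<omega> t u0 =
     Bcontfun (\<lambda>\<tau>. delay_solution \<theta> A B \<omega> u0 (t + delay_val \<tau>))"

definition entire_positive_solution ::
    "(real \<Rightarrow> 'w \<Rightarrow> 'w) \<Rightarrow> ('w \<Rightarrow> real^'n^'n) \<Rightarrow> ('w \<Rightarrow> real^'n^'n) \<Rightarrow> 'w \<Rightarrow>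
      (real \<Rightarrow> delay_interval \<Rightarrow>\<^sub>C (real^'n)) \<Rightarrow> bool" where
  "entire_positive_solution \<theta> A B \<omega> v \<longleftrightarrow>
     (\<forall>s. v s \<in> nonneg_cone) \<and>
     (\<forall>s t. 0 \<le> t \<longrightarrow> v (s + t) = delay_semiflow \<theta> A B (\<theta> s \<omega>) t (v s))"

definition OA0 :: "'w measure \<Rightarrow> (real \<Rightarrow> 'w \<Rightarrow> 'w) \<Rightarrow>
    ('w \<Rightarrow> real^'n^'n) \<Rightarrow> ('w \<Rightarrow> real^'n^'n) \<Rightarrow> bool" where
  "OA0 M \<theta> A B \<longleftrightarrow>
     A \<in> M \<rightarrow>\<^sub>M borel \<and> B \<in> M \<rightarrow>\<^sub>M borel \<and>
     (\<forall>\<omega>\<in>space M. continuous_on UNIV (\<lambda>t. A (\<theta> t \<omega>)) \<and> continuous_on UNIV (\<lambda>t. B (\<theta> t \<omega>)))"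

definition OA1 :: "'w measure \<Rightarrow> ('w \<Rightarrow> real^'n^'n) \<Rightarrow> ('w \<Rightarrow> real^'n^'n) \<Rightarrow> bool" where
  "OA1 M A B \<longleftrightarrow>
     (\<forall>\<omega>\<in>space M. (\<forall>i j. i \<noteq> j \<longrightarrow> 0 \<le> A \<omega> $ i $ j) \<and> (\<forall>i j. 0 \<le> B \<omega> $ i $ j))"

definition OA2 :: "'w measure \<Rightarrow> ('w \<Rightarrow> real^'n^'n) \<Rightarrow> ('w \<Rightarrow> real^'n^'n) \<Rightarrow> bool" where
  "OA2 M A B \<longleftrightarrow>
     integrable M (\<lambda>\<omega>. MAX (i, j)\<in>UNIV. A \<omega> $ i $ j) \<and>
     integrable M (\<lambda>\<omega>. MAX (i, j)\<in>UNIV. B \<omega> $ i $ j)"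

text \<open>The logarithm on \<open>[0,\<infinity>)\<close> with \<open>ln 0 = -\<infinity>\<close> (the library sets \<open>ln 0 = 0\<close>).\<close>

definition eln :: "real \<Rightarrow> ereal" where
  "eln x = (if x = 0 then -\<infinity> else ereal (ln x))"

end

theory Submission
  imports Defs "HOL-Complex_Analysis.Great_Picard" "HOL-Library.Diagonal_Subsequence"
begin

text \<open>
  The solution is built for each \<open>\<omega>\<close> separately. Along an orbit the system is a
  nonautonomous linear delay equation \<open>u'(t) = a(t) u(t) + b(t) u(t - 1)\<close> on \<open>\<real>\<close>, with
  continuous coefficients, nonnegative off-diagonal entries of \<open>a\<close> and nonnegative entries of
  \<open>b\<close>. An integrating factor in each component removes the diagonal of \<open>a\<close>, so one may assume
  an equation \<open>w'(t) = p(t) w(t) + q(t) w(t - 1)\<close> with all entries of \<open>p\<close> and \<open>q\<close> nonnegative.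
  Its nonnegative solutions are nondecreasing in every component, and this monotonicity makes a
  compactness argument work: if the components of \<open>w(0)\<close> have sum \<open>1\<close>, then \<open>w\<close> is bounded by
  \<open>1\<close> on the whole past, and Gronwall's inequality bounds \<open>w\<close> on \<open>[0,K]\<close>, because the delayed
  values are dominated by the present one.

  One therefore takes nonnegative approximate solutions started at times that tend to
  \<open>-\<infinity>\<close>, normalised at time \<open>0\<close> (\<open>normalised_lagged_solution_exists\<close>), for which these bounds
  are uniform (\<open>normalised_lagged_solution_bounds\<close>). By the Arzela--Ascoli theorem and a diagonal
  argument a subsequence converges locally uniformly on \<open>\<real>\<close>, and the limit is an entire
  nonnegative solution with \<open>w(0) \<noteq> 0\<close> (\<open>nonneg_entire_solution_exists\<close>). In the approximate
  equations the undelayed term \<open>w(t)\<close> is replaced by \<open>w(t - h)\<close> with a small \<open>h > 0\<close>; they are then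
  solved by finitely many integrations, and \<open>h \<rightarrow> 0\<close> in the limit.

  Finally, uniqueness for the initial value problem (\<open>is_delay_solution_unique\<close>) identifies
  the segments of the entire solution with the orbits of the semiflow.
\<close>

section \<open>Calculus for vector-valued functions\<close>

lemma antiderivative_on_reals:
  fixes f :: "real \<Rightarrow> 'a::euclidean_space"
  assumes "continuous_on UNIV f"
  obtains F where "\<And>t. (F has_vector_derivative f t) (at t)"
  using einterval_antiderivative[of "-\<infinity>" "\<infinity>" f] assms
  by (auto simp: continuous_on_eq_continuous_at)

lemma has_vector_derivative_imp_component:
  fixes f :: "real \<Rightarrow> real^'n"
  assumes "(f has_vector_derivative d) F"
  shows "((\<lambda>t. f t $ i) has_real_derivative d $ i) F"
  using bounded_linear.has_vector_derivative[OF bounded_linear_vec_nth assms]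
  by (simp add: has_real_derivative_iff_has_vector_derivative)

lemma has_vector_derivative_vecI:
  fixes f :: "real \<Rightarrow> real^'n"
  assumes "\<And>i. ((\<lambda>t. f t $ i) has_real_derivative d $ i) (at t within S)"
  shows "(f has_vector_derivative d) (at t within S)"
proof -
  have "((\<lambda>t. \<Sum>i\<in>UNIV. f t $ i *\<^sub>R axis i (1::real)) has_vector_derivative
         (\<Sum>i\<in>UNIV. d $ i *\<^sub>R axis i 1)) (at t within S)"
    by (intro has_vector_derivative_sum)
      (use has_vector_derivative_scaleR[OF assms has_vector_derivative_const] in force)
  then show ?thesis
    by (simp add: basis_expansion scalar_mult_eq_scaleR[symmetric])
qed

lemma continuous_on_interval_bounded_above:
  fixes f :: "real \<Rightarrow> real"
  assumes "continuous_on {c..d} f"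
  shows "\<exists>C\<ge>0. \<forall>t\<in>{c..d}. f t \<le> C"
proof -
  have "bounded (f ` {c..d})"
    by (intro compact_imp_bounded compact_continuous_image assms compact_Icc)
  then obtain B where B: "\<forall>y\<in>f ` {c..d}. norm y \<le> B"
    unfolding bounded_iff by blast
  show ?thesis
  proof (intro exI[of _ "\<bar>B\<bar>"] conjI ballI)
    fix t assume "t \<in> {c..d}"
    then have "norm (f t) \<le> B" using B by blast
    then show "f t \<le> \<bar>B\<bar>" by simp
  qed simp
qed

lemma mono_component_of_nonneg_derivative:
  fixes w :: "real \<Rightarrow> real^'n"
  assumes "\<And>t. (w has_vector_derivative d t) (at t)" and "\<And>t. 0 \<le> d t $ i" and "s \<le> t"
  shows "w s $ i \<le> w t $ i"
  using has_vector_derivative_imp_component[OF assms(1)] assms(2)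
  by (intro DERIV_nonneg_imp_nondecreasing[OF assms(3)]) blast

lemma sum_matrix_vector_mult_le:
  fixes p :: "real^'n^'n"
  assumes "\<And>i j. 0 \<le> p $ i $ j" and "\<And>j. 0 \<le> x $ j"
  shows "(\<Sum>i\<in>UNIV. (p *v x) $ i) \<le> (\<Sum>i\<in>UNIV. \<Sum>j\<in>UNIV. p $ i $ j) * (\<Sum>j\<in>UNIV. x $ j)"
proof -
  have "(\<Sum>i\<in>UNIV. (p *v x) $ i) = (\<Sum>i\<in>UNIV. \<Sum>j\<in>UNIV. p $ i $ j * x $ j)"
    by (simp add: matrix_vector_mult_def)
  also have "\<dots> \<le> (\<Sum>i\<in>UNIV. \<Sum>j\<in>UNIV. p $ i $ j * (\<Sum>k\<in>UNIV. x $ k))"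
    using assms by (intro sum_mono mult_left_mono member_le_sum) auto
  finally show ?thesis
    by (simp add: sum_distrib_right)
qed

lemma norm_matrix_vector_mult_le:
  fixes p :: "real^'n^'m"
  shows "norm (p *v x) \<le> (\<Sum>i\<in>UNIV. \<Sum>j\<in>UNIV. \<bar>p $ i $ j\<bar>) * norm x"
proof -
  have "norm (p *v x) \<le> (\<Sum>i\<in>UNIV. \<bar>(p *v x) $ i\<bar>)"
    by (rule norm_le_l1_cart)
  also have "\<dots> \<le> (\<Sum>i\<in>UNIV. \<Sum>j\<in>UNIV. \<bar>p $ i $ j * x $ j\<bar>)"
    by (simp add: matrix_vector_mult_def sum_mono)
  also have "\<dots> \<le> (\<Sum>i\<in>UNIV. \<Sum>j\<in>UNIV. \<bar>p $ i $ j\<bar> * norm x)"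
    by (intro sum_mono) (auto simp: abs_mult component_le_norm_cart intro: mult_left_mono)
  finally show ?thesis
    by (simp add: sum_distrib_right)
qed

lemma continuous_on_matrix_component:
  fixes p :: "'a::topological_space \<Rightarrow> real^'n^'m"
  assumes "continuous_on S p"
  shows "continuous_on S (\<lambda>t. p t $ i $ j)"
  using assms by (intro continuous_intros)

lemma continuous_on_matrix_vector_mult:
  fixes p :: "'a::topological_space \<Rightarrow> real^'n^'m"
  assumes "continuous_on S p" "continuous_on S x"
  shows "continuous_on S (\<lambda>t. p t *v x t)"
  unfolding matrix_vector_mult_def
  by (intro continuous_on_vec_lambda continuous_intros assms)

lemma matrix_vector_mult_nonneg:
  fixes p :: "real^'n^'n"
  assumes "\<And>i j. 0 \<le> p $ i $ j" and "\<And>j. 0 \<le> x $ j"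
  shows "0 \<le> (p *v x) $ i"
  using assms by (auto simp: matrix_vector_mult_def intro!: sum_nonneg)

section \<open>Locally uniform subsequential limits on the real line\<close>

text \<open>
  The bounds on \<open>[-K,K]\<close> are required only for all sufficiently large \<open>n\<close>, depending on \<open>K\<close>.
\<close>

lemma local_Arzela_Ascoli:
  fixes F :: "nat \<Rightarrow> real \<Rightarrow> 'b::{real_normed_vector,heine_borel}"
  assumes "\<And>K. 0 \<le> K \<Longrightarrow> \<exists>M L N. \<forall>n\<ge>N. \<forall>s\<in>{-K..K}. \<forall>t\<in>{-K..K}.
             norm (F n t) \<le> M \<and> norm (F n s - F n t) \<le> L * \<bar>s - t\<bar>"
  obtains g k where "strict_mono (k :: nat \<Rightarrow> nat)"
    "\<And>K. uniform_limit {-K..K} (\<lambda>n. F (k n)) g sequentially"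
proof -
  define P where "P m s \<longleftrightarrow> (\<exists>g. uniform_limit {-real m..real m} (\<lambda>n. F (s n)) g sequentially)"
    for m :: nat and s :: "nat \<Rightarrow> nat"
  interpret subseqs P
  proof
    fix m and s :: "nat \<Rightarrow> nat" assume s: "strict_mono s"
    obtain M L N where b: "\<And>n t. n \<ge> N \<Longrightarrow> t \<in> {-real m..real m} \<Longrightarrow> norm (F n t) \<le> M"
      and l: "\<And>n t u. n \<ge> N \<Longrightarrow> t \<in> {-real m..real m} \<Longrightarrow> u \<in> {-real m..real m} \<Longrightarrow>
              norm (F n t - F n u) \<le> L * \<bar>t - u\<bar>"
      using assms[of "real m"] by fastforce
    have sN: "N \<le> s (n + N)" for n
      using seq_suble[OF s, of "n + N"] by simp
    obtain g k where k: "strict_mono (k :: nat \<Rightarrow> nat)"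
      "\<And>e. 0 < e \<Longrightarrow> \<exists>n0. \<forall>n x. n \<ge> n0 \<and> x \<in> {-real m..real m} \<longrightarrow> norm (F (s (k n + N)) x - g x) < e"
    proof (rule Arzela_Ascoli[of "{-real m..real m}" "\<lambda>n. F (s (n + N))" M])
      fix x and e :: real assume x: "x \<in> {-real m..real m}" and e: "0 < e"
      let ?d = "e / (\<bar>L\<bar> + 1)"
      have "norm (F (s (n + N)) x - F (s (n + N)) y) < e"
        if "y \<in> {-real m..real m}" "norm (x - y) < ?d" for n y
      proof -
        have "norm (F (s (n + N)) x - F (s (n + N)) y) \<le> L * \<bar>x - y\<bar>"
          by (rule l[OF sN x that(1)])
        also have "\<dots> \<le> (\<bar>L\<bar> + 1) * \<bar>x - y\<bar>"
          by (intro mult_right_mono) auto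
        also have "\<dots> < e"
          using that(2) by (simp add: field_simps)
        finally show ?thesis .
      qed
      then show "\<exists>d>0. \<forall>n y. y \<in> {-real m..real m} \<and> norm (x - y) < d \<longrightarrow>
            norm (F (s (n + N)) x - F (s (n + N)) y) < e"
        using e by (intro exI[of _ ?d]) (auto simp: divide_pos_pos)
    qed (use b sN in auto)
    have "strict_mono (\<lambda>n. k n + N)"
      using k(1) by (simp add: strict_mono_def)
    moreover have "P m (s \<circ> (\<lambda>n. k n + N))"
      unfolding P_def uniform_limit_iff eventually_sequentially dist_norm o_def
      using k(2) by (intro exI[of _ g]) blast
    ultimately show "\<exists>r'. strict_mono r' \<and> P m (s \<circ> r')"
      by blast
  qed
  have stable: "P n (s \<circ> r)" if r: "strict_mono r" and P: "P n s" for r s n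
  proof -
    obtain g where "uniform_limit {-real n..real n} (\<lambda>n. F (s n)) g sequentially"
      using P unfolding P_def by blast
    then have "uniform_limit {-real n..real n} (\<lambda>n. F (s (r n))) g sequentially"
      by (rule filterlim_compose[OF _ filterlim_subseq[OF r]])
    then show ?thesis unfolding P_def by auto
  qed
  have "P m (diagseq \<circ> (+) (Suc m))" for m
    by (rule diagseq_holds[OF stable])
  then have "\<forall>m. \<exists>g. uniform_limit {-real m..real m} (\<lambda>n. F (diagseq (Suc m + n))) g sequentially"
    unfolding P_def o_def by blast
  then have "\<exists>G. \<forall>m. uniform_limit {-real m..real m} (\<lambda>n. F (diagseq (Suc m + n))) (G m) sequentially"
    by (rule choice)
  then obtain G where shifted:
    "\<And>m. uniform_limit {-real m..real m} (\<lambda>n. F (diagseq (Suc m + n))) (G m) sequentially"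
    by blast
  have G: "uniform_limit {-real m..real m} (\<lambda>n. F (diagseq n)) (G m) sequentially" for m
  proof (rule uniform_limitI)
    fix e :: real assume "0 < e"
    then have "\<forall>\<^sub>F n in sequentially. \<forall>x\<in>{-real m..real m}. dist (F (diagseq (n + Suc m)) x) (G m x) < e"
      unfolding add.commute[of _ "Suc m"] by (rule uniform_limitD[OF shifted])
    then show "\<forall>\<^sub>F n in sequentially. \<forall>x\<in>{-real m..real m}. dist (F (diagseq n) x) (G m x) < e"
      by (rule eventually_sequentially_seg[THEN iffD1])
  qed
  define g where "g t = lim (\<lambda>n. F (diagseq n) t)" for t
  have Gg: "G m t = g t" if "t \<in> {-real m..real m}" for m t
    using limI[OF tendsto_uniform_limitI[OF G that]] by (simp add: g_def)
  show thesis
  proof (rule that[of diagseq g])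
    show "strict_mono diagseq" by (rule subseq_diagseq)
    fix K :: real
    obtain m :: nat where m: "K \<le> m" using real_arch_simple by blast
    have "uniform_limit {-real m..real m} (\<lambda>n. F (diagseq n)) g sequentially"
      using G[of m] Gg by (subst uniform_limit_cong'[where g = "\<lambda>n. F (diagseq n)" and i = "G m"]) auto
    then show "uniform_limit {-K..K} (\<lambda>n. F (diagseq n)) g sequentially"
      by (rule uniform_limit_on_subset) (use m in auto)
  qed
qed

section \<open>Approximate solutions with nonnegative coefficients\<close>

text \<open>
  Method of steps: if the equation holds up to time \<open>T0 + m h\<close>, then integrating its right-hand
  side, which only involves values at times \<open>t - h\<close> and \<open>t - 1 \<le> t - h\<close>, yields a function that
  satisfies it up to time \<open>T0 + (m + 1) h\<close>. Since the coefficients vanish up to time \<open>T0\<close>, the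
  iteration can start from the constant function \<open>1\<close>.
\<close>

lemma lagged_solution_exists:
  fixes p q :: "real \<Rightarrow> real^'n^'n" and h T0 :: real and m :: nat
  assumes cont: "continuous_on UNIV p" "continuous_on UNIV q"
    and nonneg: "\<And>t i j. 0 \<le> p t $ i $ j" "\<And>t i j. 0 \<le> q t $ i $ j"
    and zero: "\<And>t. t \<le> T0 \<Longrightarrow> p t = 0" "\<And>t. t \<le> T0 \<Longrightarrow> q t = 0"
    and h: "0 < h" "h \<le> 1"
  shows "\<exists>w. (\<forall>t\<le>T0 + m * h. (w has_vector_derivative p t *v w (t - h) + q t *v w (t - 1)) (at t)) \<and>
    w T0 = 1 \<and> (\<forall>t i. 0 \<le> w t $ i) \<and> (\<forall>s t i. s \<le> t \<longrightarrow> w s $ i \<le> w t $ i) \<and>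
    continuous_on UNIV w"
proof (induction m)
  case 0
  show ?case
    by (rule exI[of _ "\<lambda>_. 1"]) (auto simp: zero)
next
  case (Suc m)
  then obtain w where
    w: "\<And>t. t \<le> T0 + m * h \<Longrightarrow> (w has_vector_derivative p t *v w (t - h) + q t *v w (t - 1)) (at t)"
    and w1: "w T0 = 1" and wn: "\<And>t i. 0 \<le> w t $ i"
    and wc: "continuous_on UNIV w"
    by blast
  define d where "d t = p t *v w (t - h) + q t *v w (t - 1)" for t
  have shift: "continuous_on UNIV (\<lambda>t. w (t - c))" for c
    by (rule continuous_on_compose2[OF wc]) (auto intro: continuous_intros)
  have "continuous_on UNIV d"
    unfolding d_def
    by (intro continuous_on_add continuous_on_matrix_vector_mult cont shift)
  then obtain F where F: "\<And>t. (F has_vector_derivative d t) (at t)"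
    by (rule antiderivative_on_reals) blast
  have dn: "0 \<le> d t $ i" for t i
    unfolding d_def vector_add_component
    by (intro add_nonneg_nonneg matrix_vector_mult_nonneg nonneg wn)
  define w' where "w' t = F t - F T0 + 1" for t
  have w': "(w' has_vector_derivative d t) (at t)" for t
    unfolding w'_def by (auto intro!: derivative_eq_intros F)
  have w'1: "w' T0 = 1" by (simp add: w'_def)
  have mono: "w' s $ i \<le> w' t $ i" if "s \<le> t" for s t i
    by (rule mono_component_of_nonneg_derivative[OF w' dn that])
  have T0: "T0 \<le> T0 + m * h" using h by simp
  \<comment> \<open>Up to \<open>T0 + m h\<close> both functions have derivative \<open>d\<close> and they agree at \<open>T0\<close>.\<close>
  have eq: "w' t = w t" if "t \<le> T0 + m * h" for t
  proof -
    have "((\<lambda>t. w' t - w t) has_derivative (\<lambda>h. 0)) (at x within {..T0 + m * h})"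
      if "x \<in> {..T0 + m * h}" for x
    proof -
      have "((\<lambda>t. w' t - w t) has_vector_derivative d x - d x) (at x)"
        using that by (intro has_vector_derivative_diff w') (auto simp: d_def intro: w)
      then show ?thesis
        by (auto simp: has_vector_derivative_def intro: has_derivative_at_withinI)
    qed
    then obtain c where "\<And>x. x \<in> {..T0 + m * h} \<Longrightarrow> w' x - w x = c"
      using has_derivative_zero_constant[of "{..T0 + m * h}" "\<lambda>t. w' t - w t"] by auto
    from this[of T0] this[of t] show ?thesis
      using T0 that w1 w'1 by simp
  qed
  show ?case
  proof (intro exI[of _ w'] conjI allI impI)
    fix t assume "t \<le> T0 + Suc m * h"
    then have "t - h \<le> T0 + m * h" "t - 1 \<le> T0 + m * h"
      using h by (auto simp: algebra_simps)
    then show "(w' has_vector_derivative p t *v w' (t - h) + q t *v w' (t - 1)) (at t)"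
      using w'[of t] by (simp add: d_def eq)
  next
    fix t i
    show "0 \<le> w' t $ i"
    proof (cases "t \<le> T0")
      case True
      then show ?thesis using eq[of t] T0 wn[of t i] by simp
    next
      case False
      then show ?thesis using mono[of T0 t i] w'1 by simp
    qed
  next
    show "continuous_on UNIV w'"
      using w' by (meson continuous_at_imp_continuous_on has_vector_derivative_continuous)
  qed (use mono w'1 in auto)
qed

text \<open>
  Normalising at time \<open>0\<close> is possible since the components start at \<open>1\<close> and do not decrease.
\<close>

lemma normalised_lagged_solution_exists:
  fixes p q :: "real \<Rightarrow> real^'n^'n"
  assumes cont: "continuous_on UNIV p" "continuous_on UNIV q"
    and nonneg: "\<And>t i j. 0 \<le> p t $ i $ j" "\<And>t i j. 0 \<le> q t $ i $ j"
    and r: "0 < r" and h: "0 < h" "h \<le> 1"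
  obtains z where
    "\<And>t. t \<in> {-r..r} \<Longrightarrow> (z has_vector_derivative p t *v z (t - h) + q t *v z (t - 1)) (at t)"
    "\<And>t i. 0 \<le> z t $ i" "\<And>s t i. s \<le> t \<Longrightarrow> z s $ i \<le> z t $ i" "(\<Sum>i\<in>UNIV. z 0 $ i) = 1"
proof -
  \<comment> \<open>The cutoff vanishes before \<open>-r - 1\<close>, where the solution starts, and is \<open>1\<close> on the interval where
    the equation is needed.\<close>
  define cut where "cut t = max 0 (min 1 (t + r + 1))" for t :: real
  have cut: "continuous_on UNIV cut" "\<And>t. 0 \<le> cut t" "\<And>t. t \<le> -r - 1 \<Longrightarrow> cut t = 0" "\<And>t. -r \<le> t \<Longrightarrow> cut t = 1"
    unfolding cut_def by (auto intro!: continuous_intros)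
  obtain m :: nat where m: "2 * r + 1 \<le> m * h"
    using reals_Archimedean3[OF h(1)] less_imp_le by blast
  have "\<exists>w. (\<forall>t\<le>(-r - 1) + m * h.
        (w has_vector_derivative (cut t *\<^sub>R p t) *v w (t - h) + (cut t *\<^sub>R q t) *v w (t - 1)) (at t)) \<and>
      w (-r - 1) = 1 \<and> (\<forall>t i. 0 \<le> w t $ i) \<and> (\<forall>s t i. s \<le> t \<longrightarrow> w s $ i \<le> w t $ i) \<and>
      continuous_on UNIV w"
    by (rule lagged_solution_exists) (auto simp: cut(2,3) nonneg h intro!: continuous_on_scaleR cut(1) cont)
  then obtain w where
    w: "\<And>t. t \<le> (-r - 1) + m * h \<Longrightarrow>
          (w has_vector_derivative (cut t *\<^sub>R p t) *v w (t - h) + (cut t *\<^sub>R q t) *v w (t - 1)) (at t)"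
    and w1: "w (-r - 1) = 1" and wn: "\<And>t i. 0 \<le> w t $ i"
    and wm: "\<And>s t i. s \<le> t \<Longrightarrow> w s $ i \<le> w t $ i"
    by blast
  define c where "c = (\<Sum>i\<in>UNIV. w 0 $ i)"
  have "1 \<le> w 0 $ i" for i
    using wm[of "-r-1" 0 i] w1 r by simp
  then have "(\<Sum>i\<in>(UNIV::'n set). 1) \<le> c"
    unfolding c_def by (intro sum_mono) auto
  then have c: "0 < c"
    by (smt (verit) sum_pos finite_class.finite_UNIV UNIV_not_empty)
  show thesis
  proof (rule that[of "\<lambda>t. (1 / c) *\<^sub>R w t"])
    fix t assume t: "t \<in> {-r..r}"
    then have "(w has_vector_derivative p t *v w (t - h) + q t *v w (t - 1)) (at t)"
      using w[of t] m cut(4)[of t] by simp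
    then have "((\<lambda>t. (1 / c) *\<^sub>R w t) has_vector_derivative
          (1 / c) *\<^sub>R (p t *v w (t - h) + q t *v w (t - 1))) (at t)"
      by (auto intro!: derivative_eq_intros)
    then show "((\<lambda>t. (1 / c) *\<^sub>R w t) has_vector_derivative
          p t *v ((1 / c) *\<^sub>R w (t - h)) + q t *v ((1 / c) *\<^sub>R w (t - 1))) (at t)"
      by (simp add: matrix_vector_mult_scaleR scaleR_add_right)
  next
    show "(\<Sum>i\<in>UNIV. ((1 / c) *\<^sub>R w 0) $ i) = 1"
      using c by (simp add: sum_divide_distrib[symmetric] c_def[symmetric])
  qed (use c wn wm in \<open>auto intro: divide_right_mono\<close>)
qed

text \<open>
  Gronwall's inequality for the sum \<open>S(t)\<close> of the components of \<open>z(t)\<close>: by monotonicity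
  \<open>S(t - h)\<close> and \<open>S(t - 1)\<close> are at most \<open>S(t)\<close>, so \<open>S' \<le> C S\<close> on \<open>[-K,K]\<close>. The bounds depend
  neither on \<open>h\<close> nor on \<open>z\<close>.
\<close>

lemma normalised_lagged_solution_bounds:
  fixes p q :: "real \<Rightarrow> real^'n^'n"
  assumes nonneg: "\<And>t i j. 0 \<le> p t $ i $ j" "\<And>t i j. 0 \<le> q t $ i $ j"
    and h: "0 \<le> h" and K: "0 \<le> K"
    and z: "\<And>t. t \<in> {-K..K} \<Longrightarrow>
              (z has_vector_derivative p t *v z (t - h) + q t *v z (t - 1)) (at t)"
    and zn: "\<And>t i. 0 \<le> z t $ i" and zm: "\<And>s t i. s \<le> t \<Longrightarrow> z s $ i \<le> z t $ i"
    and z0: "(\<Sum>i\<in>UNIV. z 0 $ i) = 1"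
    and C: "\<And>t. t \<in> {-K..K} \<Longrightarrow> (\<Sum>i\<in>UNIV. \<Sum>j\<in>UNIV. p t $ i $ j + q t $ i $ j) \<le> C" "0 \<le> C"
    and s: "s \<in> {-K..K}" and t: "t \<in> {-K..K}"
  shows "norm (z t) \<le> exp (C * K)" and "norm (z s - z t) \<le> (C * exp (C * K)) * \<bar>s - t\<bar>"
proof -
  define S where "S x = (\<Sum>i\<in>UNIV. x $ i)" for x :: "real^'n"
  define d where "d t = p t *v z (t - h) + q t *v z (t - 1)" for t
  have norm_le_S: "norm x \<le> S x" if "\<And>i. 0 \<le> x $ i" for x :: "real^'n"
    using norm_le_l1_cart[of x] that by (simp add: S_def)
  have Sm: "S (z s) \<le> S (z t)" if "s \<le> t" for s t
    unfolding S_def by (intro sum_mono zm that)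
  have dn: "0 \<le> d t $ i" for t i
    unfolding d_def vector_add_component
    by (intro add_nonneg_nonneg matrix_vector_mult_nonneg nonneg zn)
  have Sn: "0 \<le> S (z t)" for t
    unfolding S_def by (intro sum_nonneg zn)
  have Sd: "S (d t) \<le> C * S (z t)" if t: "t \<in> {-K..K}" for t
  proof -
    have "S (d t) \<le> (\<Sum>i\<in>UNIV. \<Sum>j\<in>UNIV. p t $ i $ j) * S (z (t - h)) +
                    (\<Sum>i\<in>UNIV. \<Sum>j\<in>UNIV. q t $ i $ j) * S (z (t - 1))"
      unfolding S_def d_def vector_add_component sum.distrib
      by (intro add_mono sum_matrix_vector_mult_le nonneg zn)
    also have "\<dots> \<le> (\<Sum>i\<in>UNIV. \<Sum>j\<in>UNIV. p t $ i $ j) * S (z t) +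
                    (\<Sum>i\<in>UNIV. \<Sum>j\<in>UNIV. q t $ i $ j) * S (z t)"
      using h by (intro add_mono mult_left_mono Sm sum_nonneg nonneg) auto
    also have "\<dots> = (\<Sum>i\<in>UNIV. \<Sum>j\<in>UNIV. p t $ i $ j + q t $ i $ j) * S (z t)"
      by (simp add: sum.distrib distrib_right)
    also have "\<dots> \<le> C * S (z t)"
      by (intro mult_right_mono C t Sn)
    finally show ?thesis .
  qed
  have "exp (- (C * K)) * S (z K) \<le> exp (- (C * 0)) * S (z 0)"
  proof (rule DERIV_nonpos_imp_nonincreasing[OF K])
    fix x assume x: "0 \<le> x" "x \<le> K"
    then have "x \<in> {-K..K}" by simp
    then have "((\<lambda>t. S (z t)) has_real_derivative S (d x)) (at x)"
      unfolding S_def d_def by (intro DERIV_sum has_vector_derivative_imp_component z)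
    then have "((\<lambda>t. exp (- (C * t)) * S (z t)) has_real_derivative
        exp (- (C * x)) * (S (d x) - C * S (z x))) (at x)"
      by (auto intro!: derivative_eq_intros simp: algebra_simps)
    moreover have "exp (- (C * x)) * (S (d x) - C * S (z x)) \<le> 0"
      using Sd[OF \<open>x \<in> {-K..K}\<close>] by (simp add: mult_le_0_iff)
    ultimately show "\<exists>y. ((\<lambda>t. exp (- (C * t)) * S (z t)) has_real_derivative y) (at x) \<and> y \<le> 0"
      by blast
  qed
  then have SK: "S (z K) \<le> exp (C * K)"
    using z0 by (simp add: S_def[of "z 0"] exp_minus field_simps)
  have Sb: "S (z t) \<le> exp (C * K)" if "t \<in> {-K..K}" for t
    using Sm[of t K] SK that by simp
  show "norm (z t) \<le> exp (C * K)"
    using norm_le_S[OF zn, of t] Sb[OF t] by linarith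
  have nd: "norm (d x) \<le> C * exp (C * K)" if "x \<in> {-K..K}" for x
  proof -
    have "norm (d x) \<le> S (d x)" by (rule norm_le_S[OF dn])
    also have "\<dots> \<le> C * S (z x)" by (rule Sd[OF that])
    also have "\<dots> \<le> C * exp (C * K)" by (intro mult_left_mono Sb that C)
    finally show ?thesis .
  qed
  have "norm (z s - z t) \<le> (C * exp (C * K)) * norm (s - t)"
  proof (rule differentiable_bound[of "{-K..K}"])
    show "(z has_derivative (\<lambda>h. h *\<^sub>R d x)) (at x within {-K..K})" if "x \<in> {-K..K}" for x
      using z[OF that] has_derivative_at_withinI by (auto simp: has_vector_derivative_def d_def)
    show "onorm (\<lambda>h. h *\<^sub>R d x) \<le> C * exp (C * K)" if "x \<in> {-K..K}" for x
      using nd[OF that] by (intro onorm_le) (auto simp: mult.commute mult_left_mono)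
  qed (use s t in auto)
  then show "norm (z s - z t) \<le> (C * exp (C * K)) * \<bar>s - t\<bar>"
    by simp
qed

lemma nonneg_entire_solution_exists:
  fixes p q :: "real \<Rightarrow> real^'n^'n"
  assumes cont: "continuous_on UNIV p" "continuous_on UNIV q"
    and nonneg: "\<And>t i j. 0 \<le> p t $ i $ j" "\<And>t i j. 0 \<le> q t $ i $ j"
  obtains w where "\<And>t. (w has_vector_derivative p t *v w t + q t *v w (t - 1)) (at t)"
    "\<And>t i. 0 \<le> w t $ i" "w 0 \<noteq> 0"
proof -
  \<comment> \<open>The \<open>n\<close>-th approximation solves the equation with lag \<open>1 / (n + 1)\<close> on \<open>[-(n + 1), n + 1]\<close>.\<close>
  define h where "h n = 1 / real (Suc n)" for n
  have h: "0 < h n" "h n \<le> 1" for n by (auto simp: h_def)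
  define Q where "Q n z \<longleftrightarrow> (\<forall>t\<in>{-real (Suc n)..real (Suc n)}.
          (z has_vector_derivative p t *v z (t - h n) + q t *v z (t - 1)) (at t)) \<and>
      (\<forall>t i. 0 \<le> z t $ i) \<and> (\<forall>s t i. s \<le> t \<longrightarrow> z s $ i \<le> z t $ i) \<and> (\<Sum>i\<in>UNIV. z 0 $ i) = 1"
    for n and z :: "real \<Rightarrow> real^'n"
  have "\<exists>z. Q n z" for n
  proof -
    obtain z where
      "\<And>t. t \<in> {-real (Suc n)..real (Suc n)} \<Longrightarrow>
          (z has_vector_derivative p t *v z (t - h n) + q t *v z (t - 1)) (at t)"
      "\<And>t i. 0 \<le> z t $ i" "\<And>s t i. s \<le> t \<Longrightarrow> z s $ i \<le> z t $ i" "(\<Sum>i\<in>UNIV. z 0 $ i) = 1"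
      by (rule normalised_lagged_solution_exists[OF cont nonneg _ h, of "real (Suc n)" n]) (simp, rule that)
    then show ?thesis
      unfolding Q_def by (intro exI[of _ z]) blast
  qed
  then obtain z where Q: "\<And>n. Q n (z n)"
    by metis
  have z: "(z n has_vector_derivative p t *v z n (t - h n) + q t *v z n (t - 1)) (at t)"
    if "t \<in> {-real (Suc n)..real (Suc n)}" for n t
    using Q[of n] that unfolding Q_def by blast
  have zn: "0 \<le> z n t $ i" for n t i
    using Q[of n] unfolding Q_def by blast
  have zm: "z n s $ i \<le> z n t $ i" if "s \<le> t" for n s t i
    using Q[of n] that unfolding Q_def by blast
  have z0: "(\<Sum>i\<in>UNIV. z n 0 $ i) = 1" for n
    using Q[of n] unfolding Q_def by blast
  have bound: "\<exists>C\<ge>0. \<forall>t\<in>{-K..K}. (\<Sum>i\<in>UNIV. \<Sum>j\<in>UNIV. p t $ i $ j + q t $ i $ j) \<le> C"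
    if "0 \<le> K" for K
  proof -
    have "continuous_on {-K..K} (\<lambda>t. \<Sum>i\<in>UNIV. \<Sum>j\<in>UNIV. p t $ i $ j + q t $ i $ j)"
      by (intro continuous_intros continuous_on_matrix_component continuous_on_subset[OF cont(1)]
          continuous_on_subset[OF cont(2)]) auto
    then show ?thesis
      by (rule continuous_on_interval_bounded_above)
  qed
  have est: "\<exists>M L N. \<forall>n\<ge>N. \<forall>s\<in>{-K..K}. \<forall>t\<in>{-K..K}.
             norm (z n t) \<le> M \<and> norm (z n s - z n t) \<le> L * \<bar>s - t\<bar>" if K: "0 \<le> K" for K
  proof -
    obtain C where C: "0 \<le> C"
      "\<And>t. t \<in> {-K..K} \<Longrightarrow> (\<Sum>i\<in>UNIV. \<Sum>j\<in>UNIV. p t $ i $ j + q t $ i $ j) \<le> C"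
      using bound[OF K] by blast
    obtain N :: nat where N: "K \<le> N" using real_arch_simple by blast
    have "norm (z n t) \<le> exp (C * K) \<and> norm (z n s - z n t) \<le> (C * exp (C * K)) * \<bar>s - t\<bar>"
      if "N \<le> n" "s \<in> {-K..K}" "t \<in> {-K..K}" for n s t
    proof -
      have "x \<in> {-real (Suc n)..real (Suc n)}" if "x \<in> {-K..K}" for x
        using that N \<open>N \<le> n\<close> by auto
      then have "\<And>x. x \<in> {-K..K} \<Longrightarrow>
          (z n has_vector_derivative p x *v z n (x - h n) + q x *v z n (x - 1)) (at x)"
        by (rule z)
      note b = normalised_lagged_solution_bounds[OF nonneg less_imp_le[OF h(1)] K this zn zm z0 C(2,1) that(2,3)]
      show ?thesis using b by simp
    qed
    then show ?thesis by blast
  qed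
  obtain w k where k: "strict_mono (k :: nat \<Rightarrow> nat)"
    and lim: "\<And>K. uniform_limit {-K..K} (\<lambda>n. z (k n)) w sequentially"
    by (rule local_Arzela_Ascoli[of z, OF est]) auto
  have plim: "(\<lambda>n. z (k n) t) \<longlonglongrightarrow> w t" for t
    by (rule tendsto_uniform_limitI[OF lim[of "\<bar>t\<bar>"]]) auto
  have wn: "0 \<le> w t $ i" for t i
    by (rule LIMSEQ_le_const[OF tendsto_vec_nth[OF plim]]) (use zn in auto)
  have "(\<lambda>n. \<Sum>i\<in>UNIV. z (k n) 0 $ i) \<longlonglongrightarrow> (\<Sum>i\<in>UNIV. w 0 $ i)"
    by (intro tendsto_sum tendsto_vec_nth plim)
  then have "(\<Sum>i\<in>UNIV. w 0 $ i) = 1"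
    by (simp add: z0 LIMSEQ_const_iff)
  then have w0: "w 0 \<noteq> 0" by auto
  define g where "g t = p t *v w t + q t *v w (t - 1)" for t
  have "isCont w t" for t
  proof -
    define K where "K = \<bar>t\<bar> + 1"
    obtain N :: nat where N: "K \<le> N" using real_arch_simple by blast
    have "continuous_on {-K..K} (z (k n))" if "N \<le> n" for n
    proof (rule continuous_at_imp_continuous_on, rule ballI)
      fix x assume "x \<in> {-K..K}"
      then have "x \<in> {-real (Suc (k n))..real (Suc (k n))}"
        using N that seq_suble[OF k, of n] by auto
      then show "isCont (z (k n)) x"
        using z has_vector_derivative_continuous by blast
    qed
    then have "continuous_on {-K..K} w"
      by (intro uniform_limit_theorem[OF _ lim]) (auto simp: eventually_sequentially)
    then show ?thesis
      by (rule continuous_on_interior) (auto simp: K_def)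
  qed
  then have wc: "continuous_on UNIV w"
    by (simp add: continuous_at_imp_continuous_on)
  have "continuous_on UNIV (\<lambda>t. w (t - 1))"
    by (rule continuous_on_compose2[OF wc]) (auto intro: continuous_intros)
  then have "continuous_on UNIV g"
    unfolding g_def by (intro continuous_on_add continuous_on_matrix_vector_mult cont wc)
  then obtain G where G: "\<And>t. (G has_vector_derivative g t) (at t)"
    by (rule antiderivative_on_reals) blast
  \<comment> \<open>The derivative of \<open>z (k n) - G\<close> tends to \<open>0\<close> uniformly on compact intervals, so the limit
    \<open>w - G\<close> is constant.\<close>
  have "w t - G t = w 0 - G 0" for t
  proof -
    define K where "K = \<bar>t\<bar>"
    have K: "0 \<le> K" "t \<in> {-K..K}" "0 \<in> {-K..K}" by (auto simp: K_def)
    obtain C where C: "0 \<le> C"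
      "\<And>t. t \<in> {-K..K} \<Longrightarrow> (\<Sum>i\<in>UNIV. \<Sum>j\<in>UNIV. p t $ i $ j + q t $ i $ j) \<le> C"
      using bound[OF K(1)] by blast
    obtain M L N where L: "\<And>n s t. N \<le> n \<Longrightarrow> s \<in> {-(K + 1)..K + 1} \<Longrightarrow> t \<in> {-(K + 1)..K + 1} \<Longrightarrow>
        norm (z n t) \<le> M \<and> norm (z n s - z n t) \<le> L * \<bar>s - t\<bar>"
      using est[of "K + 1"] K(1) by (metis add_nonneg_nonneg zero_le_one)
    have hlim: "(\<lambda>n. L * h (k n)) \<longlonglongrightarrow> 0"
    proof -
      have "h \<longlonglongrightarrow> 0"
        unfolding h_def by (rule LIMSEQ_inverse_real_of_nat[unfolded inverse_eq_divide])
      then have "(\<lambda>n. h (k n)) \<longlonglongrightarrow> 0"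
        using LIMSEQ_subseq_LIMSEQ[OF _ k] by (auto simp: o_def)
      then show ?thesis
        by (rule tendsto_mult_right_zero)
    qed
    have small: "norm ((w t - G t) - (w 0 - G 0)) \<le> C * e * \<bar>t\<bar>" if e: "0 < e" for e
    proof -
      have "\<forall>\<^sub>F n in sequentially. \<forall>x\<in>{-(K + 1)..K + 1}. dist (z (k n) x) (w x) < e / 2"
        by (rule uniform_limitD[OF lim]) (use e in simp)
      moreover have "\<forall>\<^sub>F n in sequentially. L * h (k n) < e / 2"
        using order_tendstoD(2)[OF hlim, of "e / 2"] e by simp
      moreover have "\<forall>\<^sub>F n in sequentially. max N (nat \<lceil>K\<rceil>) \<le> n"
        by (rule eventually_ge_at_top)
      ultimately have "\<forall>\<^sub>F n in sequentially.
          norm ((z (k n) t - G t) - (z (k n) 0 - G 0)) \<le> C * e * \<bar>t\<bar>"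
      proof eventually_elim
        case (elim n)
        have kn: "N \<le> k n" "K \<le> k n"
          using elim(3) seq_suble[OF k, of n] by linarith+
        define d where "d x = p x *v z (k n) (x - h (k n)) + q x *v z (k n) (x - 1)" for x
        have dg: "norm (d x - g x) \<le> C * e" if x: "x \<in> {-K..K}" for x
        proof -
          have "norm (z (k n) (x - h (k n)) - z (k n) x) \<le> L * \<bar>(x - h (k n)) - x\<bar>"
            using L[OF kn(1), of "x - h (k n)" x] x h[of "k n"] by auto
          then have "norm (z (k n) (x - h (k n)) - z (k n) x) < e / 2"
            using elim(2) h(1)[of "k n"] by simp
          moreover have "norm (z (k n) x - w x) < e / 2"
            using elim(1) x by (auto simp: dist_norm)
          ultimately have 1: "norm (z (k n) (x - h (k n)) - w x) \<le> e"
            using norm_triangle_ineq[of "z (k n) (x - h (k n)) - z (k n) x" "z (k n) x - w x"] by simp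
          have "x - 1 \<in> {-(K + 1)..K + 1}" using x by auto
          then have 2: "norm (z (k n) (x - 1) - w (x - 1)) \<le> e"
            using elim(1) e by (fastforce simp: dist_norm)
          have "d x - g x = p x *v (z (k n) (x - h (k n)) - w x) + q x *v (z (k n) (x - 1) - w (x - 1))"
            by (simp add: d_def g_def matrix_vector_mult_diff_distrib)
          also have "norm \<dots> \<le> (\<Sum>i\<in>UNIV. \<Sum>j\<in>UNIV. p x $ i $ j) * norm (z (k n) (x - h (k n)) - w x) +
              (\<Sum>i\<in>UNIV. \<Sum>j\<in>UNIV. q x $ i $ j) * norm (z (k n) (x - 1) - w (x - 1))"
            using norm_matrix_vector_mult_le[of "p x"] norm_matrix_vector_mult_le[of "q x"] nonneg
            by (intro norm_triangle_le add_mono) simp_all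
          also have "\<dots> \<le> (\<Sum>i\<in>UNIV. \<Sum>j\<in>UNIV. p x $ i $ j) * e + (\<Sum>i\<in>UNIV. \<Sum>j\<in>UNIV. q x $ i $ j) * e"
            by (intro add_mono mult_left_mono 1 2 sum_nonneg nonneg)
          also have "\<dots> = (\<Sum>i\<in>UNIV. \<Sum>j\<in>UNIV. p x $ i $ j + q x $ i $ j) * e"
            by (simp add: sum.distrib distrib_right)
          also have "\<dots> \<le> C * e"
            using e by (intro mult_right_mono C x) auto
          finally show ?thesis .
        qed
        have "norm ((z (k n) t - G t) - (z (k n) 0 - G 0)) \<le> (C * e) * norm (t - 0)"
        proof (rule differentiable_bound[of "{-K..K}" "\<lambda>t. z (k n) t - G t" "\<lambda>x h. h *\<^sub>R (d x - g x)"])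
          fix x assume x: "x \<in> {-K..K}"
          then have "x \<in> {-real (Suc (k n))..real (Suc (k n))}"
            using kn(2) by auto
          then have "((\<lambda>t. z (k n) t - G t) has_vector_derivative d x - g x) (at x)"
            unfolding d_def by (intro has_vector_derivative_diff z G)
          then show "((\<lambda>t. z (k n) t - G t) has_derivative (\<lambda>h. h *\<^sub>R (d x - g x))) (at x within {-K..K})"
            by (auto simp: has_vector_derivative_def intro: has_derivative_at_withinI)
          show "onorm (\<lambda>h. h *\<^sub>R (d x - g x)) \<le> C * e"
            using dg[OF x] by (intro onorm_le) (auto simp: mult.commute mult_left_mono)
        qed (use K in auto)
        then show ?case by simp
      qed
      moreover have "(\<lambda>n. norm ((z (k n) t - G t) - (z (k n) 0 - G 0))) \<longlonglongrightarrow>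
          norm ((w t - G t) - (w 0 - G 0))"
        by (intro tendsto_intros plim)
      ultimately show ?thesis
        by (intro tendsto_upperbound[of _ _ sequentially]) auto
    qed
    have "norm ((w t - G t) - (w 0 - G 0)) \<le> 0 + e" if e: "0 < e" for e
    proof -
      define r where "r = e / (C * \<bar>t\<bar> + 1)"
      have "0 < C * \<bar>t\<bar> + 1"
        using C(1) by (intro add_nonneg_pos) auto
      then have r: "0 < r" "(C * \<bar>t\<bar> + 1) * r = e"
        using e by (auto simp: r_def)
      have "norm ((w t - G t) - (w 0 - G 0)) \<le> C * r * \<bar>t\<bar>"
        by (rule small[OF r(1)])
      also have "\<dots> \<le> (C * \<bar>t\<bar> + 1) * r"
        using r(1) by (simp add: algebra_simps)
      finally show ?thesis using r(2) by simp
    qed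
    then have "norm ((w t - G t) - (w 0 - G 0)) \<le> 0"
      by (rule field_le_epsilon)
    then show ?thesis by simp
  qed
  then have weq: "w = (\<lambda>t. G t + (w 0 - G 0))"
    by (simp add: fun_eq_iff algebra_simps)
  have "(w has_vector_derivative g t) (at t)" for t
    by (subst weq) (auto intro!: derivative_eq_intros G)
  then show thesis
    unfolding g_def by (rule that[of w, OF _ wn w0])
qed

section \<open>Entire positive solutions of a cooperative delay equation\<close>

text \<open>
  The scalar equations \<open>D\<^sub>i' = a\<^sub>i\<^sub>i\<close> give the integrating factors \<open>E\<^sub>i = exp D\<^sub>i\<close>. The
  substitution \<open>u\<^sub>i = E\<^sub>i w\<^sub>i\<close> removes the diagonal of \<open>a\<close>, whose sign is unrestricted, and
  keeps the other coefficients nonnegative.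
\<close>

lemma positive_entire_solution_exists:
  fixes a b :: "real \<Rightarrow> real^'n^'n"
  assumes cont: "continuous_on UNIV a" "continuous_on UNIV b"
    and nonneg: "\<And>t i j. i \<noteq> j \<Longrightarrow> 0 \<le> a t $ i $ j" "\<And>t i j. 0 \<le> b t $ i $ j"
  obtains u where "\<And>t. (u has_vector_derivative a t *v u t + b t *v u (t - 1)) (at t)"
    "\<And>t i. 0 \<le> u t $ i" "u 0 \<noteq> 0"
proof -
  have "\<exists>D. \<forall>t. (D has_real_derivative a t $ i $ i) (at t)" for i
    using antiderivative_on_reals[OF continuous_on_matrix_component[OF cont(1)]]
    by (metis has_real_derivative_iff_has_vector_derivative)
  then obtain D where D: "\<And>i t. (D i has_real_derivative a t $ i $ i) (at t)"
    by metis
  define E where "E i t = exp (D i t)" for i t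
  have E: "0 < E i t" "E i t \<noteq> 0" for i t by (simp_all add: E_def)
  have E': "(E i has_real_derivative E i t * a t $ i $ i) (at t)" for i t
    unfolding E_def by (rule DERIV_fun_exp[OF D])
  have Ec: "continuous_on UNIV (E i)" for i
    using E' DERIV_isCont continuous_at_imp_continuous_on by blast
  have Es: "continuous_on UNIV (\<lambda>t. E i (t - 1))" for i
    by (rule continuous_on_compose2[OF Ec]) (auto intro: continuous_intros)
  define p :: "real \<Rightarrow> real^'n^'n"
    where "p t = (\<chi> i j. if i = j then 0 else a t $ i $ j * E j t / E i t)" for t
  define q :: "real \<Rightarrow> real^'n^'n"
    where "q t = (\<chi> i j. b t $ i $ j * E j (t - 1) / E i t)" for t
  have "continuous_on UNIV (\<lambda>t. if i = j then 0 else a t $ i $ j * E j t / E i t)" for i j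
    using E(2)
    by (cases "i = j") (auto intro!: continuous_intros continuous_on_matrix_component cont Ec)
  then have pc: "continuous_on UNIV p"
    unfolding p_def by (intro continuous_on_vec_lambda)
  have qc: "continuous_on UNIV q"
    unfolding q_def using E(2)
    by (intro continuous_on_vec_lambda continuous_intros continuous_on_matrix_component cont Ec Es) auto
  obtain w where w: "\<And>t. (w has_vector_derivative p t *v w t + q t *v w (t - 1)) (at t)"
    and wn: "\<And>t i. 0 \<le> w t $ i" and w0: "w 0 \<noteq> 0"
    by (rule nonneg_entire_solution_exists[OF pc qc])
      (use nonneg E(1) in \<open>auto simp: p_def q_def less_imp_le\<close>)
  show thesis
  proof (rule that[of "\<lambda>t. \<chi> i. E i t * w t $ i"])
    show "((\<lambda>t. \<chi> i. E i t * w t $ i) has_vector_derivative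
       a t *v (\<chi> i. E i t * w t $ i) + b t *v (\<chi> i. E i (t - 1) * w (t - 1) $ i)) (at t)" for t
    proof (rule has_vector_derivative_vecI)
      fix i
      let ?r = "(p t *v w t + q t *v w (t - 1)) $ i"
      have "((\<lambda>t. E i t * w t $ i) has_real_derivative
          E i t * a t $ i $ i * w t $ i + ?r * E i t) (at t)"
        by (rule DERIV_mult[OF E' has_vector_derivative_imp_component[OF w]])
      moreover have "E i t * a t $ i $ i * w t $ i + ?r * E i t =
          (a t *v (\<chi> i. E i t * w t $ i) + b t *v (\<chi> i. E i (t - 1) * w (t - 1) $ i)) $ i"
      proof -
        have "(p t *v w t) $ i * E i t = (\<Sum>j\<in>UNIV - {i}. a t $ i $ j * (E j t * w t $ j))"
          using E(2)
          by (simp add: matrix_vector_mult_def p_def sum.remove[of UNIV i] sum_distrib_left mult_ac)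
        moreover have "(q t *v w (t - 1)) $ i * E i t = (\<Sum>j\<in>UNIV. b t $ i $ j * (E j (t - 1) * w (t - 1) $ j))"
          using E(2)
          by (simp add: matrix_vector_mult_def q_def sum_distrib_left mult_ac)
        ultimately show ?thesis
          by (simp add: matrix_vector_mult_def distrib_right sum.remove[of UNIV i "\<lambda>j. a t $ i $ j * (E j t * w t $ j)"])
      qed
      ultimately show "((\<lambda>t. (\<chi> i. E i t * w t $ i) $ i) has_real_derivative
          (a t *v (\<chi> i. E i t * w t $ i) + b t *v (\<chi> i. E i (t - 1) * w (t - 1) $ i)) $ i) (at t)"
        by simp
    qed
    show "0 \<le> (\<chi> i. E i t * w t $ i) $ i" for t i
      using E(1) wn by (simp add: less_imp_le)
    show "(\<chi> i. E i 0 * w 0 $ i) \<noteq> 0"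
      using w0 E(2) by (simp add: vec_eq_iff)
  qed
qed

section \<open>Uniqueness and the semiflow\<close>

text \<open>Gronwall's inequality for the squared norm of \<open>f\<close>.\<close>

lemma linear_ode_zero_solution:
  fixes a :: "real \<Rightarrow> real^'n^'n"
  assumes cont: "continuous_on {c..d} a" "continuous_on {c..d} f"
    and deriv: "\<And>t. t \<in> {c<..<d} \<Longrightarrow> (f has_vector_derivative a t *v f t) (at t)"
    and f0: "f c = 0" and t: "t \<in> {c..d}"
  shows "f t = 0"
proof -
  have "continuous_on {c..d} (\<lambda>t. \<Sum>i\<in>UNIV. \<Sum>j\<in>UNIV. \<bar>a t $ i $ j\<bar>)"
    by (intro continuous_intros continuous_on_matrix_component cont)
  then obtain C where C: "\<And>x. x \<in> {c..d} \<Longrightarrow> (\<Sum>i\<in>UNIV. \<Sum>j\<in>UNIV. \<bar>a x $ i $ j\<bar>) \<le> C"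
    using continuous_on_interval_bounded_above by fast
  have "exp (- (2 * C * t)) * (f t \<bullet> f t) \<le> exp (- (2 * C * c)) * (f c \<bullet> f c)"
  proof (rule DERIV_nonpos_imp_decreasing_open[of c t "\<lambda>t. exp (- (2 * C * t)) * (f t \<bullet> f t)"])
    show "c \<le> t" using t by simp
    show "continuous_on {c..t} (\<lambda>t. exp (- (2 * C * t)) * (f t \<bullet> f t))"
      using t by (intro continuous_intros continuous_on_subset[OF cont(2)]) auto
    fix x assume x: "c < x" "x < t"
    let ?y = "exp (- (2 * C * x)) * (2 * (f x \<bullet> (a x *v f x)) - 2 * C * (f x \<bullet> f x))"
    have "((\<lambda>t. f t \<bullet> f t) has_vector_derivative f x \<bullet> (a x *v f x) + (a x *v f x) \<bullet> f x) (at x)"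
      using bounded_bilinear.has_vector_derivative[OF bounded_bilinear_inner deriv deriv] x t by auto
    then have "((\<lambda>t. f t \<bullet> f t) has_real_derivative 2 * (f x \<bullet> (a x *v f x))) (at x)"
      by (simp add: has_real_derivative_iff_has_vector_derivative inner_commute)
    then have "((\<lambda>t. exp (- (2 * C * t)) * (f t \<bullet> f t)) has_real_derivative ?y) (at x)"
      by (auto intro!: derivative_eq_intros simp: algebra_simps)
    moreover have "?y \<le> 0"
    proof -
      have "f x \<bullet> (a x *v f x) \<le> norm (f x) * norm (a x *v f x)"
        by (rule norm_cauchy_schwarz)
      also have "\<dots> \<le> norm (f x) * ((\<Sum>i\<in>UNIV. \<Sum>j\<in>UNIV. \<bar>a x $ i $ j\<bar>) * norm (f x))"
        by (intro mult_left_mono norm_matrix_vector_mult_le) auto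
      also have "\<dots> \<le> norm (f x) * (C * norm (f x))"
        using x t by (intro mult_left_mono mult_right_mono C) auto
      also have "\<dots> = C * (f x \<bullet> f x)"
        by (simp add: dot_square_norm power2_eq_square)
      finally show ?thesis
        by (simp add: mult_le_0_iff)
    qed
    ultimately show "\<exists>y. ((\<lambda>t. exp (- (2 * C * t)) * (f t \<bullet> f t)) has_real_derivative y) (at x) \<and> y \<le> 0"
      by blast
  qed
  then have "f t \<bullet> f t \<le> 0"
    by (simp add: f0 mult_le_0_iff)
  then show ?thesis
    by (metis inner_eq_zero_iff inner_ge_zero order_antisym)
qed

text \<open>
  Method of steps: once \<open>f\<close> vanishes on \<open>[-1,m]\<close>, the delayed term drops out on \<open>[m,m+1]\<close>.
\<close>

lemma delay_equation_zero_solution: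
  fixes a b :: "real \<Rightarrow> real^'n^'n"
  assumes cont: "continuous_on UNIV a"
    and deriv: "\<And>t. 0 \<le> t \<Longrightarrow>
      (f has_vector_derivative a t *v f t + b t *v f (t - 1)) (at t within {0..})"
    and init: "\<And>t. t \<in> {-1..0} \<Longrightarrow> f t = 0" and t: "-1 \<le> t"
  shows "f t = 0"
proof -
  have fc: "continuous_on {0..} f"
    using deriv by (auto simp: continuous_on_eq_continuous_within intro: has_vector_derivative_continuous)
  have "\<forall>t\<in>{-1..real m}. f t = 0" for m
  proof (induction m)
    case 0
    then show ?case using init by simp
  next
    case (Suc m)
    have "f t = 0" if t: "t \<in> {real m..real (Suc m)}" for t
    proof (rule linear_ode_zero_solution[OF _ _ _ _ t])
      fix x assume x: "x \<in> {real m<..<real (Suc m)}"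
      then have "f (x - 1) = 0" "0 < x"
        using Suc by auto
      then show "(f has_vector_derivative a x *v f x) (at x)"
        using deriv[of x] by (simp add: at_within_interior[of x "{0..}"])
    qed (use Suc in \<open>auto intro: continuous_on_subset[OF cont] continuous_on_subset[OF fc]\<close>)
    then show ?case
      using Suc by (metis atLeastAtMost_iff linear)
  qed
  moreover obtain m :: nat where "t \<le> m" using real_arch_simple by blast
  ultimately show ?thesis using t by auto
qed

lemma is_delay_solution_unique:
  assumes cont: "continuous_on UNIV (\<lambda>t. A (\<theta> t \<omega>))"
    and u: "is_delay_solution \<theta> A B \<omega> u0 u" and v: "is_delay_solution \<theta> A B \<omega> u0 v"
  shows "u = v"
proof (rule extensionalityI)
  show "u \<in> extensional {-1..}" "v \<in> extensional {-1..}"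
    using u v by (auto simp: is_delay_solution_def)
  fix t :: real assume "t \<in> {-1..}"
  have init: "u t - v t = 0" if "t \<in> {-1..0}" for t
  proof -
    have "u (delay_val (Delay_val t)) = v (delay_val (Delay_val t))"
      using u v by (simp add: is_delay_solution_def)
    then show ?thesis using that by (simp add: Delay_val_inverse)
  qed
  have diff: "((\<lambda>t. u t - v t) has_vector_derivative
      A (\<theta> t \<omega>) *v (u t - v t) + B (\<theta> t \<omega>) *v (u (t - 1) - v (t - 1))) (at t within {0..})"
    if "0 \<le> t" for t
  proof -
    have "((\<lambda>t. u t - v t) has_vector_derivative
      (A (\<theta> t \<omega>) *v u t + B (\<theta> t \<omega>) *v u (t - 1)) -
      (A (\<theta> t \<omega>) *v v t + B (\<theta> t \<omega>) *v v (t - 1))) (at t within {0..})"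
      using u v that by (intro has_vector_derivative_diff) (auto simp: is_delay_solution_def)
    then show ?thesis
      by (simp add: matrix_vector_mult_diff_distrib algebra_simps)
  qed
  have "u t - v t = 0"
    by (rule delay_equation_zero_solution[where f = "\<lambda>t. u t - v t", OF cont diff init])
      (use \<open>t \<in> {-1..}\<close> in auto)
  then show "u t = v t" by simp
qed

text \<open>
  Where the initial value problem has a solution, uniqueness makes it the value of the definite
  description in \<^const>\<open>delay_solution\<close>; for the initial values needed here a solution is at hand.
\<close>

lemma delay_semiflow_of_solution:
  assumes cont: "continuous_on UNIV (\<lambda>t. A (\<theta> t \<omega>))"
    and u: "\<And>t. (u has_vector_derivative A (\<theta> t \<omega>) *v u t + B (\<theta> t \<omega>) *v u (t - 1)) (at t)"
    and t: "0 \<le> t"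
  shows "delay_semiflow \<theta> A B \<omega> t (Bcontfun (\<lambda>\<tau>. u (delay_val \<tau>))) =
    Bcontfun (\<lambda>\<tau>. u (t + delay_val \<tau>))"
proof -
  let ?u0 = "Bcontfun (\<lambda>\<tau>. u (delay_val \<tau>))"
  have dv: "-1 \<le> delay_val \<tau>" for \<tau>
    using delay_val[of \<tau>] by simp
  have uc: "continuous_on S u" for S
    using u by (meson continuous_at_imp_continuous_on has_vector_derivative_continuous)
  have "(\<lambda>\<tau>. u (0 + delay_val \<tau>)) \<in> bcontfun"
    by (rule segment_in_bcontfun[OF uc])
  then have u0: "apply_bcontfun ?u0 \<tau> = u (delay_val \<tau>)" for \<tau>
    by (simp add: Bcontfun_inverse)
  have "(restrict u {-1..} has_vector_derivative
      A (\<theta> t \<omega>) *v restrict u {-1..} t + B (\<theta> t \<omega>) *v restrict u {-1..} (t - 1)) (at t within {0..})"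
    if t: "0 \<le> t" for t
  proof -
    have "(u has_vector_derivative A (\<theta> t \<omega>) *v u t + B (\<theta> t \<omega>) *v u (t - 1)) (at t within {0..})"
      using u by (rule has_vector_derivative_at_within)
    then have "(restrict u {-1..} has_vector_derivative
        A (\<theta> t \<omega>) *v u t + B (\<theta> t \<omega>) *v u (t - 1)) (at t within {0..})"
      by (rule has_vector_derivative_transform[rotated 2]) (use t in auto)
    then show ?thesis using t by simp
  qed
  then have "is_delay_solution \<theta> A B \<omega> ?u0 (restrict u {-1..})"
    using dv by (auto simp: is_delay_solution_def u0)
  then have "delay_solution \<theta> A B \<omega> ?u0 = restrict u {-1..}"
    unfolding delay_solution_def
    using is_delay_solution_unique[where A = A and \<theta> = \<theta> and \<omega> = \<omega>, OF cont]
    by (intro the_equality) blast+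
  then show ?thesis
    unfolding delay_semiflow_def using t dv
    by (simp add: add_nonneg_nonneg add_increasing)
qed

section \<open>Entire positive solutions of the random delay system\<close>

theorem theorem4p1:
  fixes M :: "'w measure" and \<theta> :: "real \<Rightarrow> 'w \<Rightarrow> 'w"
    and A B :: "'w \<Rightarrow> real^'n^'n"
  assumes "ergodic_mds M \<theta>"
    and "CARD('n) \<ge> 2"
    and "OA0 M \<theta> A B" and "OA1 M A B" and "OA2 M A B"
    and "\<forall>\<omega>\<in>space M. invertible (B \<omega>)"
    and "AE \<omega> in M. \<exists>L::ereal. L > -\<infinity> \<and>
           ((\<lambda>t. eln (onorm (delay_semiflow \<theta> A B \<omega> t)) / ereal t) \<longlongrightarrow> L) at_top"
  shows "AE \<omega> in M. \<exists>v. entire_positive_solution \<theta> A B \<omega> v \<and> (\<exists>s. v s \<noteq> 0)"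
proof (rule AE_I2)
  interpret ergodic_mds M \<theta> by fact
  fix \<omega> assume \<omega>: "\<omega> \<in> space M"
  have orbit: "\<theta> t \<omega> \<in> space M" for t
  proof -
    have "(t, \<omega>) \<in> space (borel \<Otimes>\<^sub>M M)"
      using \<omega> by (simp add: space_pair_measure)
    then show ?thesis
      using measurable_space[OF flow_measurable] by fastforce
  qed
  have cont: "continuous_on UNIV (\<lambda>t. A (\<theta> t \<omega>))" "continuous_on UNIV (\<lambda>t. B (\<theta> t \<omega>))"
    if "\<omega> \<in> space M" for \<omega>
    using assms(3) that by (auto simp: OA0_def)
  obtain u where u: "\<And>t. (u has_vector_derivative A (\<theta> t \<omega>) *v u t + B (\<theta> t \<omega>) *v u (t - 1)) (at t)"
    and un: "\<And>t i. 0 \<le> u t $ i" and u0: "u 0 \<noteq> 0"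
    by (rule positive_entire_solution_exists[OF cont[OF \<omega>]])
      (use assms(4) orbit in \<open>auto simp: OA1_def\<close>)
  have uc: "continuous_on S u" for S
    using u by (meson continuous_at_imp_continuous_on has_vector_derivative_continuous)
  define v where "v s = Bcontfun (\<lambda>\<tau>. u (s + delay_val \<tau>))" for s
  have v: "apply_bcontfun (v s) \<tau> = u (s + delay_val \<tau>)" for s \<tau>
    unfolding v_def by (subst Bcontfun_inverse[OF segment_in_bcontfun[OF uc]]) simp
  have flow: "v (s + t) = delay_semiflow \<theta> A B (\<theta> s \<omega>) t (v s)" if t: "0 \<le> t" for s t
  proof -
    have \<theta>: "\<theta> r (\<theta> s \<omega>) = \<theta> (s + r) \<omega>" for r
      using flow_add[OF \<omega>, of r s] by (simp add: add.commute)
    have "((\<lambda>r. u (s + r)) has_vector_derivative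
        A (\<theta> r (\<theta> s \<omega>)) *v u (s + r) + B (\<theta> r (\<theta> s \<omega>)) *v u (s + (r - 1))) (at r)" for r
    proof -
      have "((\<lambda>r. s + r) has_vector_derivative 1) (at r)"
        by (auto intro!: derivative_eq_intros)
      from vector_diff_chain_at[OF this u] show ?thesis
        by (simp add: \<theta> o_def add_diff_eq)
    qed
    from delay_semiflow_of_solution[where A = A and B = B and \<theta> = \<theta> and \<omega> = "\<theta> s \<omega>",
        OF cont(1)[OF orbit] this t]
    show ?thesis
      by (simp add: v_def add.assoc)
  qed
  have "apply_bcontfun (v 0) (Delay_val 0) \<noteq> 0"
    using u0 by (simp add: v Delay_val_inverse)
  then have "v 0 \<noteq> 0" by auto
  moreover have "entire_positive_solution \<theta> A B \<omega> v"
    using un flow by (simp add: entire_positive_solution_def nonneg_cone_def v)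
  ultimately show "\<exists>v. entire_positive_solution \<theta> A B \<omega> v \<and> (\<exists>s. v s \<noteq> 0)"
    by blast
qed

end
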